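(* Let $N\in\mathbb{N}$ be given. Let $P_N$ denote the canonical projection $P_N x=(x(1),\ldots,x(N),0,0,\ldots)$ on the sequence space under consideration. (1) $P_N\in\mathcal{A}_{\|\cdot\|}(c_0,c_0)$ and $P_N\in\mathcal{A}_{\|\cdot\|}(\ell_p,\ell_p)$ for $1\leq p\leq\infty$. (2) $P_N\in\mathcal{A}_{\mathrm{nu}}(c_0)$ and $P_N\in\mathcal{A}_{\mathrm{nu}}(\ell_p)$ for $1\leq p<\infty$.
   Context: Banach spaces are over $\mathbb{K}=\mathbb{R}$ or $\mathbb{C}$; $S_X$ is the unit sphere of $X$, $X^*$ the topological dual, $\mathcal{L}(X,Y)$ the bounded linear operators from $X$ to $Y$, $\mathcal{L}(X)=\mathcal{L}(X,X)$, and $\langle x^*,x\rangle=x^*(x)$. An operator $T\in\mathcal{L}(X,Y)$ attains its norm if $\|T(x_0)\|=\|T\|$ for some $x_0\in S_X$. Let $\Pi(X)=\{(x,x^* )\in S_X\times S_{X^*}:\langle x^*,x\rangle=1\}$ and, for $T\in\mathcal{L}(X)$, $\nu(T)=\sup\{|\langle x^*,T(x)\rangle|:(x,x^* )\in\Pi(X)\}$; $T$ attains its numerical radius if this supremum is attained. $\mathcal{A}_{\|\cdot\|}(X,Y)$ is the set of all norm-attaining $T\in\mathcal{L}(X,Y)$ with $\|T\|=1$ such that for every $\varepsilon>0$ there is $\eta(\varepsilon,T)>0$ such that whenever $x\in S_X$ satisfies $\|T(x)\|>1-\eta(\varepsilon,T)$, there is $x_0\in S_X$ with $\|T(x_0)\|=1$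 and $\|x_0-x\|<\varepsilon$. $\mathcal{A}_{\mathrm{nu}}(X)$ is the set of all numerical radius attaining $T\in\mathcal{L}(X)$ with $\nu(T)=1$ such that for every $\varepsilon>0$ there is $\eta(\varepsilon,T)>0$ such that whenever $(x,x^* )\in\Pi(X)$ satisfies $|\langle x^*,T(x)\rangle|>1-\eta(\varepsilon,T)$, there is $(x_0,x_0^* )\in\Pi(X)$ with $|\langle x_0^*,T(x_0)\rangle|=1$, $\|x_0-x\|<\varepsilon$ and $\|x_0^*-x^*\|<\varepsilon$. *)

theory Defs
  imports Complex_Main "HOL-Library.Function_Algebras" "HOL-Library.Extended_Real"
begin

text \<open>
  The spaces \<open>\<ell>\<^sub>p\<close> depend on a parameter \<open>p\<close> and have to be treated over the complex scalars as
  well, with complex-linear operators and functionals. A normed space over \<open>'k\<close> is therefore given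
  by a linear subspace \<open>carr\<close> of an ambient additive group \<open>'v\<close>, a scalar multiplication and a norm.
  Addition is that of \<open>'v\<close> (pointwise addition in the case of sequences).
\<close>

record ('k, 'v) normed_space =
  carr :: "'v set"
  smul :: "'k \<Rightarrow> 'v \<Rightarrow> 'v"
  nrm :: "'v \<Rightarrow> real"

definition unit_sphere :: "('k, 'v) normed_space \<Rightarrow> 'v set" where
  "unit_sphere X = {x \<in> carr X. nrm X x = 1}"

definition scalar_space :: "('k::real_normed_field, 'k) normed_space" where
  "scalar_space = \<lparr>carr = UNIV, smul = (*), nrm = norm\<rparr>"

text \<open>
  Operators are total functions on the ambient type of which only the restriction to the carrier
  matters: two functions that agree on \<open>carr X\<close> represent the same operator, and no notion below
  distinguishes between them.
\<close>

definition bounded_ops ::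
  "('k, 'v::ab_group_add) normed_space \<Rightarrow> ('k, 'w::ab_group_add) normed_space \<Rightarrow> ('v \<Rightarrow> 'w) set"
  where
  "bounded_ops X Y = {T.
     (\<forall>x\<in>carr X. T x \<in> carr Y) \<and>
     (\<forall>x\<in>carr X. \<forall>y\<in>carr X. T (x + y) = T x + T y) \<and>
     (\<forall>c. \<forall>x\<in>carr X. T (smul X c x) = smul Y c (T x)) \<and>
     (\<exists>B. \<forall>x\<in>carr X. nrm Y (T x) \<le> B * nrm X x)}"

definition op_norm ::
  "('k, 'v) normed_space \<Rightarrow> ('k, 'w) normed_space \<Rightarrow> ('v \<Rightarrow> 'w) \<Rightarrow> real" where
  "op_norm X Y T = (SUP x\<in>{x \<in> carr X. nrm X x \<le> 1}. nrm Y (T x))"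

definition dual :: "('k::real_normed_field, 'v::ab_group_add) normed_space \<Rightarrow> ('v \<Rightarrow> 'k) set" where
  "dual X = bounded_ops X scalar_space"

definition dual_norm :: "('k::real_normed_field, 'v) normed_space \<Rightarrow> ('v \<Rightarrow> 'k) \<Rightarrow> real" where
  "dual_norm X f = op_norm X scalar_space f"

definition attains_norm ::
  "('k, 'v) normed_space \<Rightarrow> ('k, 'w) normed_space \<Rightarrow> ('v \<Rightarrow> 'w) \<Rightarrow> bool" where
  "attains_norm X Y T \<longleftrightarrow> (\<exists>x0\<in>unit_sphere X. nrm Y (T x0) = op_norm X Y T)"

definition states ::
  "('k::real_normed_field, 'v::ab_group_add) normed_space \<Rightarrow> ('v \<times> ('v \<Rightarrow> 'k)) set" where
  "states X = {(x, f). x \<in> unit_sphere X \<and> f \<in> dual X \<and> dual_norm X f = 1 \<and> f x = 1}"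

definition numerical_radius ::
  "('k::real_normed_field, 'v::ab_group_add) normed_space \<Rightarrow> ('v \<Rightarrow> 'v) \<Rightarrow> real" where
  "numerical_radius X T = (SUP (x, f)\<in>states X. norm (f (T x)))"

definition attains_numerical_radius ::
  "('k::real_normed_field, 'v::ab_group_add) normed_space \<Rightarrow> ('v \<Rightarrow> 'v) \<Rightarrow> bool" where
  "attains_numerical_radius X T \<longleftrightarrow>
     (\<exists>(x, f)\<in>states X. norm (f (T x)) = numerical_radius X T)"

definition A_norm ::
  "('k, 'v::ab_group_add) normed_space \<Rightarrow> ('k, 'w::ab_group_add) normed_space \<Rightarrow> ('v \<Rightarrow> 'w) set"
  where
  "A_norm X Y = {T \<in> bounded_ops X Y.
     attains_norm X Y T \<and> op_norm X Y T = 1 \<and>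
     (\<forall>\<epsilon>>0. \<exists>\<eta>>0. \<forall>x\<in>unit_sphere X. nrm Y (T x) > 1 - \<eta> \<longrightarrow>
        (\<exists>x0\<in>unit_sphere X. nrm Y (T x0) = 1 \<and> nrm X (x0 - x) < \<epsilon>))}"

definition A_nu ::
  "('k::real_normed_field, 'v::ab_group_add) normed_space \<Rightarrow> ('v \<Rightarrow> 'v) set" where
  "A_nu X = {T \<in> bounded_ops X X.
     attains_numerical_radius X T \<and> numerical_radius X T = 1 \<and>
     (\<forall>\<epsilon>>0. \<exists>\<eta>>0. \<forall>(x, f)\<in>states X. norm (f (T x)) > 1 - \<eta> \<longrightarrow>
        (\<exists>(x0, f0)\<in>states X. norm (f0 (T x0)) = 1 \<and>
           nrm X (x0 - x) < \<epsilon> \<and> dual_norm X (\<lambda>y. f0 y - f y) < \<epsilon>))}"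

type_synonym 'k seq = "nat \<Rightarrow> 'k"

definition c0 :: "('k::real_normed_field, 'k seq) normed_space" where
  "c0 = \<lparr>carr = {x. x \<longlonglongrightarrow> 0}, smul = (\<lambda>c x n. c * x n), nrm = (\<lambda>x. SUP n. norm (x n))\<rparr>"

text \<open>Meaningful for \<open>1 \<le> p \<le> \<infinity>\<close> only.\<close>

definition lp :: "ereal \<Rightarrow> ('k::real_normed_field, 'k seq) normed_space" where
  "lp p =
     (if p = \<infinity> then
        \<lparr>carr = {x. Bseq x}, smul = (\<lambda>c x n. c * x n), nrm = (\<lambda>x. SUP n. norm (x n))\<rparr>
      else
        \<lparr>carr = {x. summable (\<lambda>n. norm (x n) powr real_of_ereal p)},
         smul = (\<lambda>c x n. c * x n),
         nrm = (\<lambda>x. (\<Sum>n. norm (x n) powr real_of_ereal p) powr (1 / real_of_ereal p))\<rparr>)"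

text \<open>Sequences are indexed from \<open>0\<close>, so the first \<open>N\<close> coordinates are those with index \<open>< N\<close>.\<close>

definition seq_proj :: "nat \<Rightarrow> 'k::zero seq \<Rightarrow> 'k seq" where
  "seq_proj N x = (\<lambda>n. if n < N then x n else 0)"

end

theory Submission
  imports Defs "HOL-Analysis.Inner_Product"
begin

text \<open>
  Only the behaviour of the norm under \<open>P = P\<^sub>N\<close> and \<open>Q = 1 - P\<close> matters: the norm of \<open>x\<close> is the
  \<open>p\<close>-norm, respectively the maximum, of \<open>\<parallel>P x\<parallel>\<close> and \<open>\<parallel>Q x\<parallel>\<close>. For a norm-attaining point close to
  \<open>x\<close> one takes \<open>P x / \<parallel>P x\<parallel>\<close>, respectively \<open>P x / \<parallel>P x\<parallel> + Q x\<close>.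

  For the numerical radius put \<open>\<alpha> = \<parallel>f \<circ> P\<parallel>\<close> and \<open>\<beta> = \<parallel>f \<circ> Q\<parallel>\<close>, so that \<open>|f (P x)| \<le> \<alpha> \<parallel>P x\<parallel>\<close> and
  \<open>|f (Q x)| \<le> \<beta> \<parallel>Q x\<parallel>\<close>. The form of the norm gives \<open>\<alpha> \<parallel>P x\<parallel> + \<beta> \<parallel>Q x\<parallel> \<le> 1\<close>, while \<open>f x = 1\<close>;
  hence equality holds throughout and \<open>f (P x) = \<alpha> \<parallel>P x\<parallel>\<close>. The functional \<open>(f \<circ> P) / \<alpha>\<close> therefore
  takes the value 1 at the normalised point, and its distance to \<open>f\<close> is at most
  \<open>|1 - \<alpha>| + \<beta>\<close>. When \<open>p > 1\<close>, or for the maximum, \<open>\<alpha>\<close> close to 1 forces \<open>\<beta>\<close> to be small. For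
  \<open>p = 1\<close> it does not, but then \<open>f\<close> itself can be kept. No description of the dual spaces is needed.
\<close>

text \<open>The sort below contains both \<open>real\<close> and \<open>complex\<close>; the inner product provides the strict
  convexity of the scalar norm.\<close>

lemma eq_of_real_if_add_eq_one:
  fixes u v :: "'k::{real_normed_field,real_inner}"
  assumes "u + v = 1" "norm u \<le> a" "norm v \<le> b" "a + b \<le> 1"
  shows "u = of_real a"
proof -
  have "1 \<le> norm u + norm v"
    using norm_triangle_ineq[of u v] assms(1) by simp
  with assms have na: "norm u = a" and nb: "norm v = 1 - a" by linarith+
  have v: "v = 1 - u" using assms(1) by (simp add: algebra_simps)
  have one: "inner (1::'k) 1 = 1" by (simp flip: power2_norm_eq_inner)
  \<comment> \<open>Expanding the squared norm of \<open>1 - u\<close> determines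
    \<open>inner u 1 = a\<close>. As \<open>u\<close> also has norm \<open>a\<close>, this is the
    equality case of Cauchy-Schwarz, which forces \<open>u = a\<close>.\<close>
  have "(1 - a)\<^sup>2 = inner v v" by (simp add: nb flip: power2_norm_eq_inner)
  also have "\<dots> = 1 - 2 * (inner u 1) + a\<^sup>2"
    by (simp add: v inner_diff_left inner_diff_right one inner_commute[of 1 u] na
        flip: power2_norm_eq_inner[of u])
  finally have ip: "inner u 1 = a" by (simp add: power2_eq_square algebra_simps)
  have uu: "inner u u = a\<^sup>2" by (simp add: na flip: power2_norm_eq_inner)
  have "inner (u - a *\<^sub>R 1) (u - a *\<^sub>R 1) = 0"
    by (simp add: inner_diff_left inner_diff_right one inner_commute[of 1 u] ip uu power2_eq_square)
  then show ?thesis by (simp add: of_real_def)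
qed

text \<open>A generalised sign: it rotates values of a functional onto the nonnegative reals, for
  real and complex scalars alike.\<close>

lemma unimodular_mult_eq_norm:
  fixes z :: "'k::real_normed_field"
  obtains c where "norm c = 1" "c * z = of_real (norm z)"
proof (cases "z = 0")
  case True
  then show ?thesis using that[of 1] by simp
next
  case False
  then show ?thesis using that[of "of_real (norm z) / z"] by (simp add: norm_divide)
qed

section \<open>Bicontractive projections\<close>

text \<open>Linearity and idempotence hold on the whole ambient type, so they rewrite without
  carrier side conditions. The fixed state in the last assumption makes the operator norm and the
  numerical radius of \<open>P\<close> equal to 1 and attained.\<close>

locale bicontractive_projection = vector_space "smul X"
  for X :: "('k::{real_normed_field,real_inner}, 'v::ab_group_add) normed_space" +
  fixes P :: "'v \<Rightarrow> 'v"
  assumes subspace_carr: "subspace (carr X)"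
    and nrm_nonneg: "x \<in> carr X \<Longrightarrow> 0 \<le> nrm X x"
    and nrm_smul: "x \<in> carr X \<Longrightarrow> nrm X (smul X c x) = norm c * nrm X x"
    and P_linear: "module_hom (smul X) (smul X) P"
    and P_carr: "x \<in> carr X \<Longrightarrow> P x \<in> carr X"
    and P_idem: "P (P x) = P x"
    and nrm_P_le: "x \<in> carr X \<Longrightarrow> nrm X (P x) \<le> nrm X x"
    and nrm_Q_le: "x \<in> carr X \<Longrightarrow> nrm X (x - P x) \<le> nrm X x"
    and ex_fixed_state: "\<exists>(x, f) \<in> states X. P x = x"
begin

lemmas carr_closed = subspace_add[OF subspace_carr] subspace_diff[OF subspace_carr]
  subspace_scale[OF subspace_carr] subspace_0[OF subspace_carr]

lemmas P_simps =
  module_hom.add[OF P_linear]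
  module_hom.diff[OF P_linear]
  module_hom.scale[OF P_linear]

lemma nrm_zero: "nrm X 0 = 0"
  using nrm_smul[of 0 0] carr_closed by simp

lemma ball_nonempty: "{y \<in> carr X. nrm X y \<le> 1} \<noteq> {}"
  using carr_closed nrm_zero by force

section \<open>Functionals and the dual norm\<close>

lemma dual_simps:
  assumes "g \<in> dual X" "x \<in> carr X"
  shows "y \<in> carr X \<Longrightarrow> g (x + y) = g x + g y" "g (smul X c x) = c * g x"
  using assms by (auto simp: dual_def bounded_ops_def scalar_space_def)

lemma dual_bounded:
  assumes "g \<in> dual X"
  obtains B where "0 \<le> B" "\<And>x. x \<in> carr X \<Longrightarrow> norm (g x) \<le> B * nrm X x"
proof -
  obtain B where B: "\<And>x. x \<in> carr X \<Longrightarrow> norm (g x) \<le> B * nrm X x"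
    using assms unfolding dual_def bounded_ops_def scalar_space_def by auto blast
  show ?thesis
  proof (rule that[of "max 0 B"])
    fix x assume x: "x \<in> carr X"
    have "B * nrm X x \<le> max 0 B * nrm X x"
      by (intro mult_right_mono nrm_nonneg x) simp
    with B[OF x] show "norm (g x) \<le> max 0 B * nrm X x" by linarith
  qed simp
qed

lemma dual_norm_upper:
  assumes "g \<in> dual X" "x \<in> carr X" "nrm X x \<le> 1"
  shows "norm (g x) \<le> dual_norm X g"
proof -
  obtain B where B: "0 \<le> B" "\<And>x. x \<in> carr X \<Longrightarrow> norm (g x) \<le> B * nrm X x"
    using dual_bounded[OF assms(1)] by blast
  have "norm (g y) \<le> B" if "y \<in> carr X" "nrm X y \<le> 1" for y
    using B(2)[OF that(1)] mult_left_mono[OF that(2) B(1)] by simp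
  then have "bdd_above ((\<lambda>x. norm (g x)) ` {x \<in> carr X. nrm X x \<le> 1})"
    by (auto intro!: bdd_aboveI2)
  with assms show ?thesis
    unfolding dual_norm_def op_norm_def scalar_space_def by (auto intro: cSUP_upper)
qed

lemma dual_norm_least:
  assumes "\<And>y. y \<in> carr X \<Longrightarrow> nrm X y \<le> 1 \<Longrightarrow> norm (g y) \<le> K"
  shows "dual_norm X g \<le> K"
  unfolding dual_norm_def op_norm_def scalar_space_def
  using assms ball_nonempty by (auto intro!: cSUP_least)

text \<open>The weight \<open>t\<close> may be 0, so that weighted estimates can later be tested on
  pairs with a vanishing entry; that case is checked at the zero vector.\<close>

lemma dual_norm_scaled_least:
  assumes "0 \<le> t" "\<And>y. y \<in> carr X \<Longrightarrow> nrm X y \<le> 1 \<Longrightarrow> t * norm (g y) \<le> K"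
  shows "t * dual_norm X g \<le> K"
proof (cases "t = 0")
  case True
  with assms(2)[of 0] show ?thesis by (simp add: carr_closed nrm_zero)
next
  case False
  with assms(1) have "0 < t" by simp
  then have "dual_norm X g \<le> K / t"
    using assms(2) by (intro dual_norm_least) (auto simp: field_simps)
  with \<open>0 < t\<close> show ?thesis by (simp add: field_simps)
qed

lemma norm_dual_le:
  assumes g: "g \<in> dual X" and x: "x \<in> carr X"
  shows "norm (g x) \<le> dual_norm X g * nrm X x"
proof (cases "nrm X x = 0")
  \<comment> \<open>Normalising is impossible here; the bound \<open>B * nrm X x\<close> forces
    \<open>g x = 0\<close> instead.\<close>
  case True
  obtain B where "norm (g x) \<le> B * nrm X x"
    using dual_bounded[OF g] x by blast
  with True show ?thesis by simp
next
  case False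
  with nrm_nonneg[OF x] have pos: "0 < nrm X x" by simp
  define y where "y = smul X (of_real (1 / nrm X x)) x"
  have "norm (g y) \<le> dual_norm X g"
    using x pos by (intro dual_norm_upper g) (auto simp: y_def carr_closed nrm_smul norm_divide)
  moreover have "norm (g y) = norm (g x) / nrm X x"
    using pos by (simp add: y_def dual_simps[OF g x] norm_mult norm_divide)
  ultimately show ?thesis using pos by (simp add: field_simps)
qed

text \<open>Serves \<open>P\<close> and its complement; the scalar \<open>c\<close> is 1 for the
  plain components of a functional and the reciprocal of a norm for the normalised one.\<close>

lemma dual_comp:
  assumes g: "g \<in> dual X" and L: "module_hom (smul X) (smul X) L"
    and carr: "\<And>x. x \<in> carr X \<Longrightarrow> L x \<in> carr X"
    and le: "\<And>x. x \<in> carr X \<Longrightarrow> nrm X (L x) \<le> nrm X x"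
  shows "(\<lambda>x. c * g (L x)) \<in> dual X"
proof -
  obtain B where B: "0 \<le> B" "\<And>x. x \<in> carr X \<Longrightarrow> norm (g x) \<le> B * nrm X x"
    using dual_bounded[OF g] by blast
  have "norm (c * g (L x)) \<le> norm c * B * nrm X x" if "x \<in> carr X" for x
  proof -
    have "norm (g (L x)) \<le> B * nrm X x"
      using B(2)[OF carr[OF that]] mult_left_mono[OF le[OF that] B(1)] by linarith
    then show ?thesis by (simp add: norm_mult mult.assoc mult_left_mono)
  qed
  moreover note L
  ultimately show ?thesis
    by (auto simp: dual_def bounded_ops_def scalar_space_def carr
        module_hom.add[OF L] module_hom.scale[OF L]
        dual_simps[OF g] distrib_left)
qed

section \<open>Components of a functional along the projection and its complement\<close>

abbreviation Q :: "'v \<Rightarrow> 'v" where "Q x \<equiv> x - P x"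

lemma Q_linear: "module_hom (smul X) (smul X) Q"
  using P_linear by (simp add: module_hom_iff scale_right_diff_distrib)

lemma Q_carr: "x \<in> carr X \<Longrightarrow> Q x \<in> carr X"
  by (simp add: carr_closed P_carr)

lemma dual_P: "g \<in> dual X \<Longrightarrow> (\<lambda>x. c * g (P x)) \<in> dual X"
  by (rule dual_comp[OF _ P_linear P_carr nrm_P_le])

lemma dual_Q: "g \<in> dual X \<Longrightarrow> (\<lambda>x. c * g (Q x)) \<in> dual X"
  by (rule dual_comp[OF _ Q_linear Q_carr nrm_Q_le])

abbreviation \<alpha> :: "('v \<Rightarrow> 'k) \<Rightarrow> real" where "\<alpha> f \<equiv> dual_norm X (\<lambda>x. f (P x))"
abbreviation \<beta> :: "('v \<Rightarrow> 'k) \<Rightarrow> real" where "\<beta> f \<equiv> dual_norm X (\<lambda>x. f (Q x))"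

text \<open>By idempotence the functional \<open>f \<circ> P\<close> can be evaluated at
  \<open>P x\<close> instead of \<open>x\<close>, which brings in the norm of
  \<open>P x\<close>.\<close>

lemma norm_f_P_le:
  assumes "f \<in> dual X" "x \<in> carr X"
  shows "norm (f (P x)) \<le> \<alpha> f * nrm X (P x)"
  using norm_dual_le[OF dual_P[OF assms(1), of 1], of "P x"] P_carr assms by (simp add: P_idem)

lemma norm_f_Q_le:
  assumes "f \<in> dual X" "x \<in> carr X"
  shows "norm (f (Q x)) \<le> \<beta> f * nrm X (Q x)"
  using norm_dual_le[OF dual_Q[OF assms(1), of 1], of "Q x"] Q_carr assms
  by (simp add: P_idem P_simps)

lemma f_P_add_f_Q:
  assumes "f \<in> dual X" "x \<in> carr X"
  shows "f (P x) + f (Q x) = f x"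
  using dual_simps(1)[OF assms(1) P_carr[OF assms(2)] Q_carr[OF assms(2)]] by simp

text \<open>Multiplying the two components by unimodular scalars makes both values of the functional
  nonnegative, so the supremum can be taken over them independently.\<close>

lemma dual_norm_components_le:
  assumes f: "f \<in> dual X" "dual_norm X f = 1" and ts: "0 \<le> t" "0 \<le> s"
    and ball: "\<And>y z. y \<in> carr X \<Longrightarrow> z \<in> carr X \<Longrightarrow> P y = y \<Longrightarrow> P z = 0 \<Longrightarrow>
      nrm X y \<le> t \<Longrightarrow> nrm X z \<le> s \<Longrightarrow> nrm X (y + z) \<le> 1"
  shows "t * \<alpha> f + s * \<beta> f \<le> 1"
proof -
  have key: "t * norm (f (P y)) + s * norm (f (Q z)) \<le> 1"
    if y: "y \<in> carr X" "nrm X y \<le> 1" and z: "z \<in> carr X" "nrm X z \<le> 1" for y z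
  proof -
    obtain c where c: "norm c = 1" "c * f (P y) = of_real (norm (f (P y)))"
      using unimodular_mult_eq_norm .
    obtain d where d: "norm d = 1" "d * f (Q z) = of_real (norm (f (Q z)))"
      using unimodular_mult_eq_norm .
    \<comment> \<open>Applying the projections first puts \<open>y'\<close> in the range and
      \<open>z'\<close> in the kernel of \<open>P\<close>, as \<open>ball\<close> demands;
      \<open>c\<close> and \<open>d\<close> align the two values of \<open>f\<close>, while
      \<open>t\<close> and \<open>s\<close> set the sizes.\<close>
    define y' where "y' = smul X (of_real t * c) (P y)"
    define z' where "z' = smul X (of_real s * d) (Q z)"
    have yc: "y' \<in> carr X" and zc: "z' \<in> carr X"
      by (simp_all add: y'_def z'_def carr_closed P_carr y z)
    have ny: "nrm X y' \<le> t"
      using ts(1) order_trans[OF nrm_P_le[OF y(1)] y(2)] mult_left_le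
      by (simp add: y'_def nrm_smul P_carr y norm_mult c)
    have nz: "nrm X z' \<le> s"
      using ts(2) order_trans[OF nrm_Q_le[OF z(1)] z(2)] mult_left_le
      by (simp add: z'_def nrm_smul Q_carr z norm_mult d)
    have "nrm X (y' + z') \<le> 1"
      by (rule ball[OF yc zc _ _ ny nz]) (simp_all add: y'_def z'_def P_simps P_idem)
    then have "norm (f (y' + z')) \<le> 1"
      using dual_norm_upper[OF f(1)] f(2) carr_closed yc zc by metis
    moreover have "f (y' + z') = of_real (t * norm (f (P y)) + s * norm (f (Q z)))"
      using yc zc y z c(2) d(2)
      by (simp add: dual_simps[OF f(1)] y'_def z'_def P_carr Q_carr mult.assoc)
    ultimately show ?thesis
      using ts by (simp only: norm_of_real)
  qed
  \<comment> \<open>The supremum is taken over \<open>z\<close> with \<open>y\<close> fixed, and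
    only then over \<open>y\<close>.\<close>
  have "t * norm (f (P y)) \<le> 1 - s * \<beta> f" if y: "y \<in> carr X" "nrm X y \<le> 1" for y
  proof -
    have "s * \<beta> f \<le> 1 - t * norm (f (P y))"
      using key[OF y] ts(2) by (intro dual_norm_scaled_least) (auto simp: algebra_simps)
    then show ?thesis by simp
  qed
  then have "t * \<alpha> f \<le> 1 - s * \<beta> f"
    by (intro dual_norm_scaled_least ts)
  then show ?thesis by simp
qed

lemma f_P_eq:
  assumes "(x, f) \<in> states X" "\<alpha> f * nrm X (P x) + \<beta> f * nrm X (Q x) \<le> 1"
  shows "f (P x) = of_real (\<alpha> f * nrm X (P x))"
proof (rule eq_of_real_if_add_eq_one)
  have f: "f \<in> dual X" and x: "x \<in> carr X" and "f x = 1"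
    using assms(1) by (auto simp: states_def unit_sphere_def)
  then show "f (P x) + f (Q x) = 1" by (simp add: f_P_add_f_Q)
  show "norm (f (P x)) \<le> \<alpha> f * nrm X (P x)" "norm (f (Q x)) \<le> \<beta> f * nrm X (Q x)"
    using norm_f_P_le[OF f x] norm_f_Q_le[OF f x] by auto
qed (rule assms(2))

text \<open>The difference \<open>f0 - f\<close> is \<open>(1 / \<alpha> f - 1)\<close> times
  \<open>f \<circ> P\<close>, minus \<open>f \<circ> Q\<close>. The first term contributes at most
  \<open>\<bar>1 - \<alpha> f\<bar>\<close> because \<open>f \<circ> P\<close> has norm
  \<open>\<alpha> f\<close>.\<close>

lemma normalized_f_P:
  assumes f: "f \<in> dual X" and pos: "0 < \<alpha> f"
    and f0_def: "f0 = (\<lambda>x. of_real (1 / \<alpha> f) * f (P x))"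
  shows "f0 \<in> dual X" "dual_norm X f0 = 1"
    and "dual_norm X (\<lambda>y. f0 y - f y) \<le> \<bar>1 - \<alpha> f\<bar> + \<beta> f"
proof -
  show d: "f0 \<in> dual X" unfolding f0_def by (rule dual_P[OF f])
  have nf: "norm (f0 y) = norm (f (P y)) / \<alpha> f" for y
    using pos by (simp add: f0_def norm_mult norm_divide)
  have fP: "norm (f (P y)) \<le> \<alpha> f" if "y \<in> carr X" "nrm X y \<le> 1" for y
    using dual_norm_upper[OF dual_P[OF f, of 1] that] by simp
  have fQ: "norm (f (Q y)) \<le> \<beta> f" if "y \<in> carr X" "nrm X y \<le> 1" for y
    using dual_norm_upper[OF dual_Q[OF f, of 1] that] by simp
  have "dual_norm X f0 \<le> 1"
    using pos fP by (intro dual_norm_least) (simp add: nf)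
  moreover have "1 * \<alpha> f \<le> dual_norm X f0 * \<alpha> f"
  proof (rule dual_norm_scaled_least)
    fix y assume y: "y \<in> carr X" "nrm X y \<le> 1"
    show "1 * norm (f (P y)) \<le> dual_norm X f0 * \<alpha> f"
      using dual_norm_upper[OF d y] pos by (simp add: nf field_simps)
  qed simp
  ultimately show "dual_norm X f0 = 1" using pos by simp
  show "dual_norm X (\<lambda>y. f0 y - f y) \<le> \<bar>1 - \<alpha> f\<bar> + \<beta> f"
  proof (rule dual_norm_least)
    fix y assume y: "y \<in> carr X" "nrm X y \<le> 1"
    have "f0 y - f y = of_real (1 / \<alpha> f - 1) * f (P y) - f (Q y)"
      using f_P_add_f_Q[OF f y(1)] by (simp add: f0_def algebra_simps)
    then have "norm (f0 y - f y) \<le> norm (of_real (1 / \<alpha> f - 1) * f (P y)) + norm (f (Q y))"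
      by (simp only: norm_triangle_ineq4)
    also have "norm (of_real (1 / \<alpha> f - 1) * f (P y)) = \<bar>1 / \<alpha> f - 1\<bar> * norm (f (P y))"
      by (simp only: norm_mult norm_of_real)
    also have "\<dots> \<le> \<bar>1 / \<alpha> f - 1\<bar> * \<alpha> f"
      by (intro mult_left_mono fP y) simp
    also have "\<dots> = \<bar>(1 / \<alpha> f - 1) * \<alpha> f\<bar>"
      using pos by (simp add: abs_mult)
    also have "\<dots> = \<bar>1 - \<alpha> f\<bar>"
      using pos by (simp add: algebra_simps)
    finally show "norm (f0 y - f y) \<le> \<bar>1 - \<alpha> f\<bar> + \<beta> f"
      using fQ[OF y] by simp
  qed
qed

section \<open>Operator norm and numerical radius of the projection\<close>

lemma P_bounded: "P \<in> bounded_ops X X"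
  unfolding bounded_ops_def by (auto simp: P_carr P_simps intro!: exI[of _ 1] nrm_P_le)

lemma op_norm_P: "op_norm X X P = 1" and attains_norm_P: "attains_norm X X P"
proof -
  obtain e where e: "e \<in> unit_sphere X" "P e = e"
    using ex_fixed_state by (auto simp: states_def)
  show *: "op_norm X X P = 1"
    unfolding op_norm_def
  proof (rule cSup_eq_maximum)
    show "1 \<in> (\<lambda>x. nrm X (P x)) ` {x \<in> carr X. nrm X x \<le> 1}"
      using e by (force simp: unit_sphere_def)
    show "r \<le> 1" if "r \<in> (\<lambda>x. nrm X (P x)) ` {x \<in> carr X. nrm X x \<le> 1}" for r
      using that nrm_P_le by (auto intro: order_trans)
  qed
  show "attains_norm X X P"
    using e * unfolding attains_norm_def by (force simp: unit_sphere_def)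
qed

text \<open>Turns near-attainment of the numerical radius at a state into near-attainment of the
  norm at its point.\<close>

lemma norm_state_P_le:
  assumes "(x, f) \<in> states X"
  shows "norm (f (P x)) \<le> nrm X (P x)" "nrm X (P x) \<le> 1"
  using assms norm_dual_le[of f "P x"] nrm_P_le[of x] P_carr[of x]
  by (auto simp: states_def unit_sphere_def)

lemma numerical_radius_P: "numerical_radius X P = 1"
  and attains_numerical_radius_P: "attains_numerical_radius X P"
proof -
  obtain e h where e: "(e, h) \<in> states X" "P e = e"
    using ex_fixed_state by auto
  then have he: "norm (h (P e)) = 1" by (simp add: states_def)
  show *: "numerical_radius X P = 1"
    unfolding numerical_radius_def
  proof (rule cSup_eq_maximum)
    show "1 \<in> (\<lambda>(x, f). norm (f (P x))) ` states X"
      using e(1) he by (force intro: rev_image_eqI)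
    show "r \<le> 1" if "r \<in> (\<lambda>(x, f). norm (f (P x))) ` states X" for r
      using that norm_state_P_le order_trans by fastforce
  qed
  show "attains_numerical_radius X P"
    using e(1) he * unfolding attains_numerical_radius_def by force
qed

lemma P_in_A_norm:
  assumes "\<And>\<epsilon>. 0 < \<epsilon> \<Longrightarrow> \<exists>\<eta>>0. \<forall>x\<in>unit_sphere X. nrm X (P x) > 1 - \<eta> \<longrightarrow>
    (\<exists>x0\<in>unit_sphere X. nrm X (P x0) = 1 \<and> nrm X (x0 - x) < \<epsilon>)"
  shows "P \<in> A_norm X X"
  using assms P_bounded op_norm_P attains_norm_P by (simp add: A_norm_def)

lemma P_in_A_nu:
  assumes "\<And>\<epsilon>. 0 < \<epsilon> \<Longrightarrow> \<exists>\<eta>>0. \<forall>x f. (x, f) \<in> states X \<longrightarrow> norm (f (P x)) > 1 - \<eta> \<longrightarrow>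
    (\<exists>x0 f0. (x0, f0) \<in> states X \<and> norm (f0 (P x0)) = 1 \<and>
       nrm X (x0 - x) < \<epsilon> \<and> dual_norm X (\<lambda>y. f0 y - f y) < \<epsilon>)"
  shows "P \<in> A_nu X"
proof -
  have "\<exists>\<eta>>0. \<forall>(x, f)\<in>states X. norm (f (P x)) > 1 - \<eta> \<longrightarrow>
        (\<exists>(x0, f0)\<in>states X. norm (f0 (P x0)) = 1 \<and>
           nrm X (x0 - x) < \<epsilon> \<and> dual_norm X (\<lambda>y. f0 y - f y) < \<epsilon>)" if "0 < \<epsilon>" for \<epsilon>
    using assms[OF that] by (simp add: Ball_def Bex_def)
  then show ?thesis
    using P_bounded numerical_radius_P attains_numerical_radius_P by (simp add: A_nu_def)
qed

end

section \<open>Projections splitting the norm as a \<open>p\<close>-norm\<close>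

locale lp_projection = bicontractive_projection X P
  for X :: "('k::{real_normed_field,real_inner}, 'v::ab_group_add) normed_space" and P +
  fixes p :: real
  assumes one_le_p: "1 \<le> p"
    and nrm_powr: "x \<in> carr X \<Longrightarrow>
      nrm X x powr p = nrm X (P x) powr p + nrm X (x - P x) powr p"
begin

lemma unit_powr_split:
  assumes "x \<in> unit_sphere X"
  shows "nrm X (P x) powr p + nrm X (Q x) powr p = 1"
  using assms nrm_powr[of x] by (simp add: unit_sphere_def)

text \<open>If \<open>P x\<close> has norm 0, the factor \<open>1 / 0\<close> is 0 and the value is
  the zero vector; the normalising facts assume a positive norm.\<close>

definition normalized_P :: "'v \<Rightarrow> 'v" where
  "normalized_P x = smul X (of_real (1 / nrm X (P x))) (P x)"

text \<open>With \<open>a\<close> the norm of \<open>P x\<close>, the displacement has a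
  \<open>P\<close>-component of norm \<open>1 - a\<close> and a \<open>Q\<close>-component equal to
  \<open>- Q x\<close>, whose norm to the power \<open>p\<close> is
  \<open>1 - a powr p\<close>.\<close>

lemma normalized_P:
  assumes x: "x \<in> unit_sphere X" and pos: "0 < nrm X (P x)"
  shows "normalized_P x \<in> unit_sphere X" "P (normalized_P x) = normalized_P x"
    and "nrm X (normalized_P x - x) powr p \<le> (1 - nrm X (P x)) + (1 - nrm X (P x) powr p)"
proof -
  let ?a = "nrm X (P x)"
  have xc: "x \<in> carr X" "nrm X x = 1" using x by (auto simp: unit_sphere_def)
  have a1: "?a \<le> 1" using nrm_P_le[OF xc(1)] xc(2) by simp
  show n: "normalized_P x \<in> unit_sphere X"
    using pos xc by (simp add: normalized_P_def unit_sphere_def carr_closed P_carr nrm_smul norm_divide)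
  show Pn: "P (normalized_P x) = normalized_P x"
    by (simp add: normalized_P_def P_simps P_idem)
  have c: "normalized_P x - x \<in> carr X"
    using n xc by (simp add: unit_sphere_def carr_closed)
  have d: "P (normalized_P x - x) = normalized_P x - P x"
    by (simp only: P_simps Pn)
  also have "\<dots> = smul X (of_real (1 / ?a - 1)) (P x)"
    by (simp add: normalized_P_def scale_left_diff_distrib)
  finally have "nrm X (P (normalized_P x - x)) = \<bar>1 / ?a - 1\<bar> * ?a"
    using P_carr[OF xc(1)] by (simp only: nrm_smul norm_of_real)
  also have "\<dots> = 1 - ?a"
    using pos a1 by (simp add: field_simps abs_if)
  finally have 1: "nrm X (P (normalized_P x - x)) = 1 - ?a" .
  have "Q (normalized_P x - x) = smul X (-1) (Q x)"
    by (simp add: d)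
  then have 2: "nrm X (Q (normalized_P x - x)) = nrm X (Q x)"
    using Q_carr[OF xc(1)] by (simp only: nrm_smul) simp
  \<comment> \<open>The base lies between 0 and 1 and \<open>p\<close> is at least 1, so the power
    may be replaced by the base itself.\<close>
  have "(1 - ?a) powr p \<le> (1 - ?a) powr 1"
    using a1 pos one_le_p by (intro powr_mono') auto
  then show "nrm X (normalized_P x - x) powr p \<le> (1 - ?a) + (1 - ?a powr p)"
    using nrm_powr[OF c] unit_powr_split[OF x] a1 by (simp only: 1 2) simp
qed

text \<open>The bound on the displacement is continuous in the norm of \<open>P x\<close> and
  vanishes at 1. Keeping \<open>\<delta> \<le> 1\<close> makes that norm positive.\<close>

lemma normalized_P_near:
  assumes "0 < \<epsilon>"
  obtains \<delta> where "0 < \<delta>" "\<delta> \<le> 1"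
    "\<And>x. x \<in> unit_sphere X \<Longrightarrow> 1 - \<delta> < nrm X (P x) \<Longrightarrow> nrm X (normalized_P x - x) < \<epsilon>"
proof -
  have "((\<lambda>a. (1 - a) + (1 - a powr p)) \<longlongrightarrow> (1 - 1) + (1 - 1 powr p)) (nhds 1)"
    by (intro tendsto_intros filterlim_ident) auto
  then have "eventually (\<lambda>a. (1 - a) + (1 - a powr p) < \<epsilon> powr p) (nhds 1)"
    using assms by (intro order_tendstoD) auto
  then obtain d where d: "0 < d" "\<And>a. dist a 1 < d \<Longrightarrow> (1 - a) + (1 - a powr p) < \<epsilon> powr p"
    by (auto simp: eventually_nhds_metric)
  show ?thesis
  proof (rule that[of "min d 1"])
    fix x assume x: "x \<in> unit_sphere X" "1 - min d 1 < nrm X (P x)"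
    have le: "nrm X (P x) \<le> 1"
      using nrm_P_le[of x] x by (auto simp: unit_sphere_def)
    have "0 < nrm X (P x)" "dist (nrm X (P x)) 1 < d"
      using x(2) le by (auto simp: dist_real_def)
    then have "nrm X (normalized_P x - x) powr p < \<epsilon> powr p"
      using normalized_P(3)[OF x(1)] d(2) by (meson le_less_trans)
    then show "nrm X (normalized_P x - x) < \<epsilon>"
      using assms one_le_p powr_mono2[of p \<epsilon> "nrm X (normalized_P x - x)"] by force
  qed (use d in auto)
qed

theorem P_in_A_norm_lp: "P \<in> A_norm X X"
proof (rule P_in_A_norm)
  fix \<epsilon> :: real assume "0 < \<epsilon>"
  then obtain \<delta> where \<delta>: "0 < \<delta>" "\<delta> \<le> 1"
    "\<And>x. x \<in> unit_sphere X \<Longrightarrow> 1 - \<delta> < nrm X (P x) \<Longrightarrow> nrm X (normalized_P x - x) < \<epsilon>"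
    using normalized_P_near by metis
  show "\<exists>\<eta>>0. \<forall>x\<in>unit_sphere X. nrm X (P x) > 1 - \<eta> \<longrightarrow>
    (\<exists>x0\<in>unit_sphere X. nrm X (P x0) = 1 \<and> nrm X (x0 - x) < \<epsilon>)"
  proof (intro exI conjI ballI impI)
    fix x assume x: "x \<in> unit_sphere X" "nrm X (P x) > 1 - \<delta>"
    then have "0 < nrm X (P x)" using \<delta>(2) by linarith
    from normalized_P(1,2)[OF x(1) this] \<delta>(3)[OF x]
    show "\<exists>x0\<in>unit_sphere X. nrm X (P x0) = 1 \<and> nrm X (x0 - x) < \<epsilon>"
      by (intro bexI[of _ "normalized_P x"]) (auto simp: unit_sphere_def)
  qed (rule \<delta>)
qed

text \<open>In effect the pair \<open>(\<alpha> f, \<beta> f)\<close> lies in the dual unit ball of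
  two-dimensional \<open>lp\<close>, expressed through test pairs \<open>(t, s)\<close> rather than
  a conjugate exponent.\<close>

lemma dual_norm_components_le_lp:
  assumes f: "f \<in> dual X" "dual_norm X f = 1" and ts: "0 \<le> t" "0 \<le> s"
    and le: "t powr p + s powr p \<le> 1"
  shows "t * \<alpha> f + s * \<beta> f \<le> 1"
proof (rule dual_norm_components_le[OF f ts])
  fix y z assume yz: "y \<in> carr X" "z \<in> carr X" "P y = y" "P z = 0" "nrm X y \<le> t" "nrm X z \<le> s"
  have c: "y + z \<in> carr X" using yz by (simp add: carr_closed)
  have "nrm X (y + z) powr p = nrm X y powr p + nrm X z powr p"
    using nrm_powr[OF c] yz by (simp add: P_simps)
  also have "\<dots> \<le> t powr p + s powr p"
    using yz one_le_p by (intro add_mono powr_mono2 nrm_nonneg) auto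
  finally have "nrm X (y + z) powr p \<le> 1" using le by simp
  then show "nrm X (y + z) \<le> 1"
    using one_le_p powr_less_mono2[of p 1 "nrm X (y + z)"] by fastforce
qed

theorem P_in_A_nu_lp: "P \<in> A_nu X"
proof (rule P_in_A_nu)
  fix \<epsilon> :: real assume \<epsilon>: "0 < \<epsilon>"
  then obtain \<delta> where \<delta>: "0 < \<delta>" "\<delta> \<le> 1"
    "\<And>x. x \<in> unit_sphere X \<Longrightarrow> 1 - \<delta> < nrm X (P x) \<Longrightarrow> nrm X (normalized_P x - x) < \<epsilon>"
    using normalized_P_near by metis
  have fx0: "f (normalized_P x) = of_real (1 / nrm X (P x)) * f (P x)"
    if "(x, f) \<in> states X" for x f
    using that by (auto simp: states_def unit_sphere_def normalized_P_def dual_simps P_carr)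
  show "\<exists>\<eta>>0. \<forall>x f. (x, f) \<in> states X \<longrightarrow> norm (f (P x)) > 1 - \<eta> \<longrightarrow>
    (\<exists>x0 f0. (x0, f0) \<in> states X \<and> norm (f0 (P x0)) = 1 \<and>
       nrm X (x0 - x) < \<epsilon> \<and> dual_norm X (\<lambda>y. f0 y - f y) < \<epsilon>)"
  proof (cases "p = 1")
    case True
    show ?thesis
    proof (intro exI[of _ \<delta>] conjI allI impI)
      fix x f assume st: "(x, f) \<in> states X" and "norm (f (P x)) > 1 - \<delta>"
      then have near: "1 - \<delta> < nrm X (P x)" using norm_state_P_le[OF st] by linarith
      then have pos: "0 < nrm X (P x)" using \<delta>(2) by linarith
      have f: "f \<in> dual X" "dual_norm X f = 1" "f x = 1" and x: "x \<in> unit_sphere X" "x \<in> carr X"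
        using st by (auto simp: states_def unit_sphere_def)
      \<comment> \<open>For \<open>p = 1\<close> the norms of \<open>P x\<close> and
        \<open>Q x\<close> add up to 1. As \<open>f\<close> has norm 1 and \<open>f x = 1\<close>,
        no slack is left in either component.\<close>
      have "f (P x) = of_real (nrm X (P x))"
      proof (rule eq_of_real_if_add_eq_one)
        show "f (P x) + f (Q x) = 1" using f_P_add_f_Q f x by simp
        show "norm (f (P x)) \<le> nrm X (P x)" using norm_state_P_le[OF st] by simp
        show "norm (f (Q x)) \<le> nrm X (Q x)" using norm_dual_le[OF f(1) Q_carr[OF x(2)]] f(2) by simp
        show "nrm X (P x) + nrm X (Q x) \<le> 1"
          using unit_powr_split[OF x(1)] nrm_nonneg[OF P_carr[OF x(2)]] nrm_nonneg[OF Q_carr[OF x(2)]]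
          by (simp add: True)
      qed
      then have f1: "f (normalized_P x) = 1" using fx0[OF st] pos by simp
      have "dual_norm X (\<lambda>y. f y - f y) \<le> 0" by (rule dual_norm_least) simp
      with \<epsilon> f f1 normalized_P(1,2)[OF x(1) pos] \<delta>(3)[OF x(1) near]
      show "\<exists>x0 f0. (x0, f0) \<in> states X \<and> norm (f0 (P x0)) = 1 \<and>
          nrm X (x0 - x) < \<epsilon> \<and> dual_norm X (\<lambda>y. f0 y - f y) < \<epsilon>"
        by (intro exI[of _ "normalized_P x"] exI[of _ f]) (auto simp: states_def)
    qed (rule \<delta>)
  next
    case False
    then have p: "1 < p" using one_le_p by simp
    \<comment> \<open>Chosen so that \<open>s powr (p - 1) \<le> \<epsilon>/3\<close>, which needs
      \<open>p > 1\<close>: the loss \<open>s powr p\<close> in the test pair below is then at most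
      \<open>\<epsilon>/3\<close> after division by \<open>s\<close>. The bound \<open>1/2\<close>
      keeps \<open>s\<close> below 1.\<close>
    define s where "s = min (1/2) ((\<epsilon>/3) powr (1 / (p - 1)))"
    have s: "0 < s" "s < 1" using \<epsilon> by (auto simp: s_def)
    have "s powr (p - 1) \<le> ((\<epsilon>/3) powr (1 / (p - 1))) powr (p - 1)"
      using p s by (intro powr_mono2) (auto simp: s_def)
    then have sp: "s powr (p - 1) \<le> \<epsilon>/3" using p \<epsilon> by (simp add: powr_powr)
    have s_p: "s powr p = s * s powr (p - 1)" using s by (simp add: powr_diff)
    have sp1: "s powr p \<le> 1" using s p by (intro powr_le1) auto
    \<comment> \<open>\<open>\<delta>\<close> controls the point. The other bound leaves
      \<open>\<epsilon>/3\<close> after division by \<open>s\<close> and, since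
      \<open>s < 1\<close>, also gives \<open>1 - \<alpha> f < \<epsilon>/3\<close>.\<close>
    define \<eta> where "\<eta> = min \<delta> (s * \<epsilon> / 3)"
    have \<eta>: "0 < \<eta>" using \<delta> s \<epsilon> by (simp add: \<eta>_def)
    show ?thesis
    proof (intro exI[of _ \<eta>] conjI allI impI)
      fix x f assume st: "(x, f) \<in> states X" and gt: "norm (f (P x)) > 1 - \<eta>"
      have near: "1 - \<delta> < nrm X (P x)" using norm_state_P_le[OF st] gt by (simp add: \<eta>_def)
      then have pos: "0 < nrm X (P x)" using \<delta>(2) by linarith
      have f: "f \<in> dual X" "dual_norm X f = 1" "f x = 1" and x: "x \<in> unit_sphere X" "x \<in> carr X"
        using st by (auto simp: states_def unit_sphere_def)
      have \<alpha>_gt: "\<alpha> f > 1 - \<eta>"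
        using gt dual_norm_upper[OF dual_P[OF f(1), of 1] x(2)] x by (simp add: unit_sphere_def)
      then have \<alpha>_pos: "0 < \<alpha> f" using \<delta>(2) by (simp add: \<eta>_def)
      have \<alpha>_le: "\<alpha> f \<le> 1"
        using dual_norm_components_le_lp[OF f(1,2), of 1 0] by simp
      text \<open>Test the dual norm on the pair \<open>(1 - s\<^sup>p, s)\<close>, which lies in the unit ball
        because \<open>(1 - s\<^sup>p)\<^sup>p \<le> 1 - s\<^sup>p\<close>.\<close>
      have "(1 - s powr p) powr p \<le> (1 - s powr p) powr 1"
        using sp1 p by (intro powr_mono') auto
      then have "(1 - s powr p) * \<alpha> f + s * \<beta> f \<le> 1"
        using sp1 s by (intro dual_norm_components_le_lp f) auto
      moreover have "s powr p * \<alpha> f \<le> s powr p"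
        using \<alpha>_le by (simp add: mult_left_le)
      ultimately have "s * \<beta> f \<le> \<eta> + s powr p"
        using \<alpha>_gt by (simp add: algebra_simps)
      also have "\<dots> \<le> s * (\<epsilon> / 3) + s * (\<epsilon> / 3)"
        using mult_left_mono[OF sp, of s] s by (intro add_mono) (auto simp: \<eta>_def s_p)
      finally have \<beta>_le: "\<beta> f \<le> 2 * \<epsilon> / 3" using s by simp
      have "s * \<epsilon> / 3 < \<epsilon> / 3" using s \<epsilon> by simp
      then have \<alpha>_near: "1 - \<alpha> f < \<epsilon> / 3" using \<alpha>_gt by (simp add: \<eta>_def)
      \<comment> \<open>The norms of \<open>P x\<close> and \<open>Q x\<close> form an admissible
        test pair themselves, so equality holds in both components.\<close>
      have "f (P x) = of_real (\<alpha> f * nrm X (P x))"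
      proof (rule f_P_eq[OF st])
        show "\<alpha> f * nrm X (P x) + \<beta> f * nrm X (Q x) \<le> 1"
          using dual_norm_components_le_lp[OF f(1,2) nrm_nonneg[OF P_carr[OF x(2)]]
              nrm_nonneg[OF Q_carr[OF x(2)]]] unit_powr_split[OF x(1)]
          by (simp add: mult.commute)
      qed
      then have fn: "f (normalized_P x) = of_real (\<alpha> f)" using fx0[OF st] pos by simp
      define f0 where "f0 = (\<lambda>x. of_real (1 / \<alpha> f) * f (P x))"
      have "f0 (normalized_P x) = 1"
        using \<alpha>_pos by (simp add: f0_def normalized_P(2)[OF x(1) pos] fn)
      moreover note normalized_f_P[OF f(1) \<alpha>_pos f0_def]
        normalized_P(1,2)[OF x(1) pos] \<delta>(3)[OF x(1) near]
      ultimately show "\<exists>x0 f0. (x0, f0) \<in> states X \<and> norm (f0 (P x0)) = 1 \<and>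
          nrm X (x0 - x) < \<epsilon> \<and> dual_norm X (\<lambda>y. f0 y - f y) < \<epsilon>"
        using \<alpha>_near \<beta>_le \<alpha>_le
        by (intro exI[of _ "normalized_P x"] exI[of _ f0]) (auto simp: states_def)
    qed (rule \<eta>)
  qed
qed

end

section \<open>Projections splitting the norm as a maximum\<close>

locale max_projection = bicontractive_projection X P
  for X :: "('k::{real_normed_field,real_inner}, 'v::ab_group_add) normed_space" and P +
  assumes nrm_max: "x \<in> carr X \<Longrightarrow> nrm X x = max (nrm X (P x)) (nrm X (x - P x))"
begin

theorem P_in_A_norm_max: "P \<in> A_norm X X"
proof (rule P_in_A_norm)
  fix \<epsilon> :: real assume \<epsilon>: "0 < \<epsilon>"
  show "\<exists>\<eta>>0. \<forall>x\<in>unit_sphere X. nrm X (P x) > 1 - \<eta> \<longrightarrow>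
    (\<exists>x0\<in>unit_sphere X. nrm X (P x0) = 1 \<and> nrm X (x0 - x) < \<epsilon>)"
  \<comment> \<open>The displacement will have norm exactly \<open>1 - nrm X (P x)\<close>, hence
    the choice of \<open>\<epsilon>\<close>; the cap 1 keeps \<open>P x\<close> away from norm
    0.\<close>
  proof (intro exI[of _ "min \<epsilon> 1"] conjI ballI impI)
    fix x assume x: "x \<in> unit_sphere X" and gt: "nrm X (P x) > 1 - min \<epsilon> 1"
    let ?a = "nrm X (P x)"
    have xc: "x \<in> carr X" "nrm X x = 1" using x by (auto simp: unit_sphere_def)
    have pos: "0 < ?a" using gt by simp
    have a1: "?a \<le> 1" using nrm_P_le[OF xc(1)] xc(2) by simp
    \<comment> \<open>Adding \<open>d\<close> normalises the \<open>P\<close>-component of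
      \<open>x\<close> and leaves the \<open>Q\<close>-component unchanged.\<close>
    define d where "d = smul X (of_real (1 / ?a - 1)) (P x)"
    have dc: "d \<in> carr X" by (simp add: d_def carr_closed P_carr xc)
    have Pd: "P d = d" by (simp add: d_def P_simps P_idem)
    have "nrm X d = \<bar>1 / ?a - 1\<bar> * ?a"
      using P_carr[OF xc(1)] by (simp only: d_def nrm_smul norm_of_real)
    also have "\<dots> = 1 - ?a"
      using pos a1 by (simp add: field_simps abs_if)
    finally have nd: "nrm X d = 1 - ?a" .
    have "P (x + d) = smul X (of_real (1 / ?a)) (P x)"
      by (simp add: P_simps Pd) (simp add: d_def scale_left_diff_distrib)
    then have nP: "nrm X (P (x + d)) = 1"
      using pos by (simp add: nrm_smul P_carr xc norm_divide)
    have "Q (x + d) = Q x" by (simp only: P_simps Pd) simp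
    then have "nrm X (Q (x + d)) \<le> 1"
      using nrm_Q_le[OF xc(1)] xc(2) by metis
    then have "nrm X (x + d) = 1"
      using nrm_max[of "x + d"] nP xc dc by (simp add: carr_closed)
    with nP nd gt xc dc show "\<exists>x0\<in>unit_sphere X. nrm X (P x0) = 1 \<and> nrm X (x0 - x) < \<epsilon>"
      by (intro bexI[of _ "x + d"]) (auto simp: unit_sphere_def carr_closed)
  qed (use \<epsilon> in simp)
qed

text \<open>Only the functional has to move: \<open>f \<circ> P\<close> divided by
  \<open>\<alpha> f\<close> already takes the value 1 at \<open>x\<close> itself.\<close>

theorem P_in_A_nu_max: "P \<in> A_nu X"
proof (rule P_in_A_nu)
  fix \<epsilon> :: real assume \<epsilon>: "0 < \<epsilon>"
  show "\<exists>\<eta>>0. \<forall>x f. (x, f) \<in> states X \<longrightarrow> norm (f (P x)) > 1 - \<eta> \<longrightarrow>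
    (\<exists>x0 f0. (x0, f0) \<in> states X \<and> norm (f0 (P x0)) = 1 \<and>
       nrm X (x0 - x) < \<epsilon> \<and> dual_norm X (\<lambda>y. f0 y - f y) < \<epsilon>)"
  \<comment> \<open>With \<open>\<alpha> f > 1 - \<epsilon>/2\<close> and
    \<open>\<beta> f \<le> 1 - \<alpha> f\<close>, the two parts of the distance are each below
    \<open>\<epsilon>/2\<close>.\<close>
  proof (intro exI[of _ "min (\<epsilon> / 2) 1"] conjI allI impI)
    fix x f assume st: "(x, f) \<in> states X" and gt: "norm (f (P x)) > 1 - min (\<epsilon> / 2) 1"
    have f: "f \<in> dual X" "dual_norm X f = 1" "f x = 1"
      and x: "x \<in> unit_sphere X" "x \<in> carr X" "nrm X x \<le> 1"
      using st by (auto simp: states_def unit_sphere_def)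
    have fP: "norm (f (P x)) \<le> \<alpha> f" and fQ: "norm (f (Q x)) \<le> \<beta> f"
      using dual_norm_upper[OF dual_P[OF f(1), of 1] x(2,3)]
        dual_norm_upper[OF dual_Q[OF f(1), of 1] x(2,3)] by auto
    \<comment> \<open>For a maximum norm the pair \<open>(1, 1)\<close> is admissible, so the
      component norms add up to at most 1.\<close>
    have "1 * \<alpha> f + 1 * \<beta> f \<le> 1"
    proof (rule dual_norm_components_le[OF f(1,2)])
      fix y z assume "y \<in> carr X" "z \<in> carr X" "P y = y" "P z = 0" "nrm X y \<le> 1" "nrm X z \<le> 1"
      then show "nrm X (y + z) \<le> 1"
        using nrm_max[of "y + z"] by (simp add: carr_closed P_simps)
    qed simp_all
    then have le: "\<alpha> f + \<beta> f \<le> 1" by simp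
    have \<alpha>_pos: "0 < \<alpha> f" using fP gt by simp
    have eq: "f (P x) = of_real (\<alpha> f)"
      using f_P_add_f_Q[OF f(1) x(2)] f(3) by (intro eq_of_real_if_add_eq_one[OF _ fP fQ le]) simp
    define f0 where "f0 = (\<lambda>x. of_real (1 / \<alpha> f) * f (P x))"
    have "f0 x = 1" "f0 (P x) = 1"
      using \<alpha>_pos by (simp_all add: f0_def P_idem eq)
    moreover have "0 \<le> \<beta> f" using fQ norm_ge_zero order_trans by blast
    moreover have "nrm X (x - x) = 0" by (simp add: nrm_zero)
    moreover note normalized_f_P[OF f(1) \<alpha>_pos f0_def]
    moreover have "\<bar>1 - \<alpha> f\<bar> + \<beta> f < \<epsilon>"
      using le fP gt \<open>0 \<le> \<beta> f\<close> by linarith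
    ultimately show "\<exists>x0 f0. (x0, f0) \<in> states X \<and> norm (f0 (P x0)) = 1 \<and>
        nrm X (x0 - x) < \<epsilon> \<and> dual_norm X (\<lambda>y. f0 y - f y) < \<epsilon>"
      using x(1) \<epsilon>
      by (intro exI[of _ x] exI[of _ f0]) (auto simp: states_def)
  qed (use \<epsilon> in simp)
qed

end

section \<open>Sequence spaces\<close>

text \<open>Solidity and monotonicity of the norm handle both \<open>seq_proj N\<close> and its
  complement, since each only replaces coordinates by 0. The first unit vector provides the fixed
  state.\<close>

locale solid_seq_space =
  fixes X :: "('k::{real_normed_field,real_inner}, 'k seq) normed_space"
  assumes smul_eq: "smul X = (\<lambda>c x n. c * x n)"
    and carr_add: "x \<in> carr X \<Longrightarrow> y \<in> carr X \<Longrightarrow> x + y \<in> carr X"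
    and carr_smul: "x \<in> carr X \<Longrightarrow> smul X c x \<in> carr X"
    and nrm_nonneg: "x \<in> carr X \<Longrightarrow> 0 \<le> nrm X x"
    and nrm_smul: "x \<in> carr X \<Longrightarrow> nrm X (smul X c x) = norm c * nrm X x"
    and carr_solid: "x \<in> carr X \<Longrightarrow> (\<And>n. norm (y n) \<le> norm (x n)) \<Longrightarrow> y \<in> carr X"
    and nrm_mono: "x \<in> carr X \<Longrightarrow> (\<And>n. norm (y n) \<le> norm (x n)) \<Longrightarrow> nrm X y \<le> nrm X x"
    and first_unit: "(\<lambda>n. if n = 0 then 1 else 0) \<in> unit_sphere X"
begin

abbreviation e0 :: "'k seq" where "e0 \<equiv> (\<lambda>n. if n = 0 then 1 else 0)"

text \<open>The multiple \<open>x 0\<close> of \<open>e0\<close> is dominated coordinatewise by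
  \<open>x\<close>.\<close>

lemma norm_first_coord_le:
  assumes "x \<in> carr X"
  shows "norm (x 0) \<le> nrm X x"
proof -
  have "norm (x 0) = nrm X (smul X (x 0) e0)"
    using first_unit nrm_smul[of e0 "x 0"] by (simp add: unit_sphere_def)
  also have "\<dots> \<le> nrm X x"
    by (rule nrm_mono[OF assms]) (auto simp: smul_eq)
  finally show ?thesis .
qed

lemma first_coord_state: "(e0, \<lambda>x. x 0) \<in> states X"
proof -
  have "dual_norm X (\<lambda>x. x 0) = 1"
    unfolding dual_norm_def op_norm_def scalar_space_def
  proof (rule cSup_eq_maximum)
    let ?A = "(\<lambda>x. nrm \<lparr>carr = UNIV, smul = (*), nrm = norm\<rparr> (x 0)) ` {x \<in> carr X. nrm X x \<le> 1}"
    show "1 \<in> ?A"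
      using first_unit by (intro image_eqI[of _ _ e0]) (auto simp: unit_sphere_def)
    show "r \<le> 1" if "r \<in> ?A" for r
      using that norm_first_coord_le by (auto intro: order_trans)
  qed
  moreover have "(\<lambda>x. x 0) \<in> dual X"
    unfolding dual_def bounded_ops_def scalar_space_def
    using norm_first_coord_le by (auto simp: smul_eq intro!: exI[of _ 1])
  ultimately show ?thesis using first_unit by (simp add: states_def)
qed

lemma bicontractive_seq_proj:
  assumes "N \<ge> 1"
  shows "bicontractive_projection X (seq_proj N)"
proof -
  interpret vector_space "smul X"
    by unfold_locales (auto simp: smul_eq fun_eq_iff algebra_simps)
  show ?thesis
  proof
    have "0 \<in> carr X"
      using first_unit by (auto intro: carr_solid simp: unit_sphere_def)
    then show "subspace (carr X)"
      using carr_add carr_smul by (simp add: subspace_def)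
    show "seq_proj N (x + y) = seq_proj N x + seq_proj N y"
      "seq_proj N (smul X c x) = smul X c (seq_proj N x)" for x y c
      by (auto simp: smul_eq seq_proj_def)
    show "seq_proj N x \<in> carr X" if "x \<in> carr X" for x
      using that by (rule carr_solid) (simp add: seq_proj_def)
    show "nrm X (seq_proj N x) \<le> nrm X x" if "x \<in> carr X" for x
      using that by (rule nrm_mono) (simp add: seq_proj_def)
    show "nrm X (x - seq_proj N x) \<le> nrm X x" if "x \<in> carr X" for x
      using that by (rule nrm_mono) (simp add: seq_proj_def)
    \<comment> \<open>Here \<open>N \<ge> 1\<close> enters: index 0 must be among the coordinates
      kept.\<close>
    have "seq_proj N e0 = e0" using assms by (auto simp: seq_proj_def)
    then show "\<exists>(x, f)\<in>states X. seq_proj N x = x"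
      using first_coord_state by blast
  qed (auto simp: nrm_nonneg nrm_smul seq_proj_def)
qed

end

section \<open>Supremum norm: null sequences and bounded sequences\<close>

lemma Bseq_norm_le_SUP:
  fixes x :: "nat \<Rightarrow> 'a::real_normed_vector"
  assumes "Bseq x"
  shows "norm (x n) \<le> (SUP n. norm (x n))"
  using assms by (auto simp: Bseq_def intro!: cSUP_upper bdd_aboveI2)

text \<open>Common to \<open>c0\<close> and \<open>lp \<infinity>\<close>: every coordinate of
  \<open>x\<close> survives in exactly one of the two parts, so the supremum is the larger of their
  suprema.\<close>

lemma max_projection_seq_proj:
  fixes X :: "('k::{real_normed_field,real_inner}, 'k seq) normed_space"
  assumes smul: "smul X = (\<lambda>c x n. c * x n)"
    and nrm: "nrm X = (\<lambda>x. SUP n. norm (x n))"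
    and bdd: "\<And>x. x \<in> carr X \<Longrightarrow> Bseq x"
    and add: "\<And>x y. x \<in> carr X \<Longrightarrow> y \<in> carr X \<Longrightarrow> x + y \<in> carr X"
    and scale: "\<And>c x. x \<in> carr X \<Longrightarrow> (\<lambda>n. c * x n) \<in> carr X"
    and solid: "\<And>x y. x \<in> carr X \<Longrightarrow> (\<And>n. norm (y n) \<le> norm (x n)) \<Longrightarrow> y \<in> carr X"
    and first: "(\<lambda>n. if n = 0 then 1 else 0) \<in> carr X"
    and N: "N \<ge> 1"
  shows "max_projection X (seq_proj N)"
proof -
  have upper: "norm (x n) \<le> nrm X x" if "x \<in> carr X" for x n
    using Bseq_norm_le_SUP[OF bdd[OF that]] by (simp add: nrm)
  have least: "nrm X x \<le> K" if "\<And>n. norm (x n) \<le> K" for x K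
    unfolding nrm using that by (intro cSUP_least) auto
  have nonneg: "0 \<le> nrm X x" if "x \<in> carr X" for x
    using upper[OF that, of 0] norm_ge_zero order_trans by blast
  interpret solid_seq_space X
  proof
    show "nrm X (smul X c x) = norm c * nrm X x" if x: "x \<in> carr X" for c x
    proof (rule antisym)
      show "nrm X (smul X c x) \<le> norm c * nrm X x"
        by (rule least) (simp add: smul norm_mult mult_left_mono upper x)
      show "norm c * nrm X x \<le> nrm X (smul X c x)"
      proof (cases "c = 0")
        case True
        then show ?thesis using nonneg[OF scale[OF x, of c]] by (simp add: smul)
      next
        case False
        have "norm (x n) \<le> nrm X (smul X c x) / norm c" for n
          using upper[OF scale[OF x, of c], of n] False by (simp add: smul norm_mult field_simps)
        then have "nrm X x \<le> nrm X (smul X c x) / norm c" by (rule least)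
        then show ?thesis using False by (simp add: field_simps)
      qed
    qed
    show "nrm X y \<le> nrm X x" if "x \<in> carr X" "\<And>n. norm (y n) \<le> norm (x n)" for x y
      by (rule least) (rule order_trans[OF that(2) upper[OF that(1)]])
    have "nrm X (\<lambda>n. if n = 0 then 1 else 0) \<le> 1" by (rule least) simp
    with upper[OF first, of 0] show "(\<lambda>n. if n = 0 then 1 else 0) \<in> unit_sphere X"
      by (simp add: unit_sphere_def first)
  qed (use add scale solid nonneg in \<open>auto simp: smul\<close>)
  interpret bicontractive_projection X "seq_proj N" by (rule bicontractive_seq_proj[OF N])
  show ?thesis
  proof
    fix x assume x: "x \<in> carr X"
    have "norm (x n) \<le> max (nrm X (seq_proj N x)) (nrm X (x - seq_proj N x))" for n
      using upper[OF P_carr[OF x], of n] upper[OF Q_carr[OF x], of n]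
      by (cases "n < N") (auto simp: seq_proj_def)
    then have "nrm X x \<le> max (nrm X (seq_proj N x)) (nrm X (x - seq_proj N x))" by (rule least)
    then show "nrm X x = max (nrm X (seq_proj N x)) (nrm X (x - seq_proj N x))"
      using nrm_P_le[OF x] nrm_Q_le[OF x] by linarith
  qed
qed

lemma max_projection_c0:
  assumes "N \<ge> 1"
  shows "max_projection (c0 :: ('k::{real_normed_field,real_inner}, 'k seq) normed_space) (seq_proj N)"
proof (rule max_projection_seq_proj[OF _ _ _ _ _ _ _ assms])
  fix x y :: "'k seq"
  show "x \<in> carr c0 \<Longrightarrow> y \<in> carr c0 \<Longrightarrow> x + y \<in> carr c0"
    by (simp add: c0_def plus_fun_def tendsto_add_zero)
  show "x \<in> carr c0 \<Longrightarrow> (\<lambda>n. c * x n) \<in> carr c0" for c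
    by (simp add: c0_def tendsto_mult_right_zero)
  show "x \<in> carr c0 \<Longrightarrow> Bseq x"
    by (auto simp: c0_def intro: convergent_imp_Bseq convergentI)
  assume "x \<in> carr c0" "\<And>n. norm (y n) \<le> norm (x n)"
  then show "y \<in> carr c0"
    unfolding c0_def by (auto intro: tendsto_0_le[of x _ _ 1])
next
  have "eventually (\<lambda>n. (if n = 0 then 1 else 0 :: 'k) = 0) sequentially"
    by (auto simp: eventually_sequentially intro: exI[of _ 1])
  then show "(\<lambda>n. if n = 0 then 1 else 0 :: 'k) \<in> carr c0"
    by (simp add: c0_def tendsto_eventually)
qed (simp_all add: c0_def)

lemma max_projection_linf:
  assumes "N \<ge> 1"
  shows "max_projection (lp \<infinity> :: ('k::{real_normed_field,real_inner}, 'k seq) normed_space) (seq_proj N)"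
proof (rule max_projection_seq_proj[OF _ _ _ _ _ _ _ assms])
  fix x y :: "'k seq"
  show "x + y \<in> carr (lp \<infinity>)" if "x \<in> carr (lp \<infinity>)" "y \<in> carr (lp \<infinity>)"
  proof -
    have "norm ((x + y) n) \<le> (SUP n. norm (x n)) + (SUP n. norm (y n))" for n
      using Bseq_norm_le_SUP[of x n] Bseq_norm_le_SUP[of y n] norm_triangle_ineq[of "x n" "y n"] that
      by (simp add: lp_def)
    then show ?thesis by (auto simp: lp_def simp del: plus_fun_apply intro: BseqI')
  qed
  show "x \<in> carr (lp \<infinity>) \<Longrightarrow> (\<lambda>n. c * x n) \<in> carr (lp \<infinity>)" for c
    by (auto simp: lp_def intro: Bseq_mult)
  assume "x \<in> carr (lp \<infinity>)" "\<And>n. norm (y n) \<le> norm (x n)"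
  then show "y \<in> carr (lp \<infinity>)"
    by (auto simp: lp_def intro: Bseq_eventually_mono[OF always_eventually])
next
  show "(\<lambda>n. if n = 0 then 1 else 0 :: 'k) \<in> carr (lp \<infinity>)"
    by (auto simp: lp_def intro!: BseqI'[of _ 1])
qed (simp_all add: lp_def)

section \<open>Summable powers: finite exponents\<close>

text \<open>Follows from \<open>a + b \<le> 2 * max a b\<close>; the crude constant suffices for the
  summability of a sum of two sequences.\<close>

lemma powr_add_le:
  fixes a b p :: real
  assumes "0 \<le> a" "0 \<le> b" "0 \<le> p"
  shows "(a + b) powr p \<le> 2 powr p * (a powr p + b powr p)"
proof -
  have "(a + b) powr p \<le> (2 * max a b) powr p"
    using assms by (intro powr_mono2) auto
  also have "\<dots> = 2 powr p * max a b powr p"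
    using assms by (simp add: powr_mult)
  also have "max a b powr p \<le> a powr p + b powr p"
    by (simp add: max_def)
  finally show ?thesis by (simp add: mult_left_mono)
qed

lemma lp_projection_lp:
  assumes N: "N \<ge> 1" and r: "1 \<le> r"
  shows "lp_projection (lp (ereal r) :: ('k::{real_normed_field,real_inner}, 'k seq) normed_space)
    (seq_proj N) r"
proof -
  let ?X = "lp (ereal r) :: ('k, 'k seq) normed_space"
  have carr: "x \<in> carr ?X \<longleftrightarrow> summable (\<lambda>n. norm (x n) powr r)" for x
    by (simp add: lp_def)
  have smul: "smul ?X = (\<lambda>c x n. c * x n)" by (simp add: lp_def)
  have nrm: "nrm ?X x = (\<Sum>n. norm (x n) powr r) powr (1 / r)" for x by (simp add: lp_def)
  have solid: "y \<in> carr ?X" if "x \<in> carr ?X" "\<And>n. norm (y n) \<le> norm (x n)" for x y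
    unfolding carr using that(2) r
    by (intro summable_comparison_test'[OF that(1)[unfolded carr], of 0]) (auto intro: powr_mono2)
  interpret solid_seq_space ?X
  proof
    fix x y :: "'k seq" and c :: 'k
    assume x: "x \<in> carr ?X"
    have cx: "norm (smul ?X c x n) powr r = norm c powr r * norm (x n) powr r" for n
      by (simp add: smul norm_mult powr_mult)
    then show "smul ?X c x \<in> carr ?X"
      using x by (simp add: carr summable_mult)
    show "nrm ?X (smul ?X c x) = norm c * nrm ?X x"
      using x r by (simp add: nrm cx carr suminf_mult powr_mult suminf_nonneg powr_powr)
    show "0 \<le> nrm ?X x" by (simp add: nrm)
    show "x + y \<in> carr ?X" if "y \<in> carr ?X"
    proof -
      have "norm (x n + y n) powr r \<le> 2 powr r * (norm (x n) powr r + norm (y n) powr r)" for n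
        using r powr_mono2[OF _ _ norm_triangle_ineq, of r "x n" "y n"]
          powr_add_le[of "norm (x n)" "norm (y n)" r] by simp
      moreover have s: "summable (\<lambda>n. 2 powr r * (norm (x n) powr r + norm (y n) powr r))"
        using x that by (intro summable_mult summable_add) (simp_all add: carr)
      ultimately show ?thesis
        unfolding carr by (intro summable_comparison_test'[OF s, of 0]) auto
    qed
    assume le: "\<And>n. norm (y n) \<le> norm (x n)"
    show y: "y \<in> carr ?X" by (rule solid[OF x le])
    show "nrm ?X y \<le> nrm ?X x"
      unfolding nrm using x y r le
      by (intro powr_mono2 suminf_le suminf_nonneg) (auto simp: carr)
  next
    have eq: "(\<lambda>n. norm (if n = 0 then 1 else 0 :: 'k) powr r) = (\<lambda>n. if n = 0 then 1 else 0)"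
      by auto
    have "(\<lambda>n. if n = 0 then 1 else 0 :: real) sums 1"
      using sums_single[of 0 "\<lambda>_. 1::real"] by simp
    then show "(\<lambda>n. if n = 0 then 1 else 0 :: 'k) \<in> unit_sphere ?X"
      unfolding unit_sphere_def by (simp add: carr nrm eq sums_iff)
  qed (rule smul)
  interpret bicontractive_projection ?X "seq_proj N" by (rule bicontractive_seq_proj[OF N])
  show ?thesis
  proof
    fix x :: "'k seq" assume x: "x \<in> carr ?X"
    have pow: "nrm ?X y powr r = (\<Sum>n. norm (y n) powr r)" if "y \<in> carr ?X" for y
      using that r by (simp add: nrm powr_powr suminf_nonneg carr)
    \<comment> \<open>At each index one of the two terms is \<open>0 powr r = 0\<close>, so the
      disjoint supports split the sum termwise.\<close>
    have "(\<Sum>n. norm (x n) powr r) =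
        (\<Sum>n. norm (seq_proj N x n) powr r + norm ((x - seq_proj N x) n) powr r)"
      by (intro suminf_cong) (simp add: seq_proj_def)
    also have "\<dots> = (\<Sum>n. norm (seq_proj N x n) powr r) + (\<Sum>n. norm ((x - seq_proj N x) n) powr r)"
      using P_carr[OF x] Q_carr[OF x] by (intro suminf_add[symmetric]) (simp_all only: carr)
    finally show "nrm ?X x powr r = nrm ?X (seq_proj N x) powr r + nrm ?X (x - seq_proj N x) powr r"
      by (simp only: pow x P_carr Q_carr)
  qed (rule r)
qed

lemma seq_proj_in_A_norm_lp:
  assumes "N \<ge> 1" "1 \<le> p" "p \<le> \<infinity>"
  shows "seq_proj N \<in> A_norm (lp p :: ('k::{real_normed_field,real_inner}, 'k seq) normed_space) (lp p)"
proof (cases p)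
  case (real r)
  then show ?thesis
    using assms lp_projection.P_in_A_norm_lp[OF lp_projection_lp[of N r]] by simp
\<comment> \<open>For \<open>p = \<infinity>\<close> the maximum-norm result applies;
  \<open>p = -\<infinity>\<close> contradicts \<open>1 \<le> p\<close>.\<close>
qed (use assms max_projection.P_in_A_norm_max[OF max_projection_linf] in auto)

lemma seq_proj_in_A_nu_lp:
  assumes "N \<ge> 1" "1 \<le> p" "p < \<infinity>"
  shows "seq_proj N \<in> A_nu (lp p :: ('k::{real_normed_field,real_inner}, 'k seq) normed_space)"
proof (cases p)
  case (real r)
  then show ?thesis
    using assms lp_projection.P_in_A_nu_lp[OF lp_projection_lp[of N r]] by simp
qed (use assms in auto)

theorem corollary2p18:
  fixes N :: nat
  assumes "N \<ge> 1"
  shows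
    "((seq_proj N :: real seq \<Rightarrow> real seq) \<in> A_norm c0 c0 \<and>
      (\<forall>p. 1 \<le> p \<and> p \<le> \<infinity> \<longrightarrow> (seq_proj N :: real seq \<Rightarrow> real seq) \<in> A_norm (lp p) (lp p)) \<and>
      (seq_proj N :: real seq \<Rightarrow> real seq) \<in> A_nu (c0 :: (real, real seq) normed_space) \<and>
      (\<forall>p. 1 \<le> p \<and> p < \<infinity> \<longrightarrow>
         (seq_proj N :: real seq \<Rightarrow> real seq) \<in> A_nu (lp p :: (real, real seq) normed_space)))
     \<and>
     ((seq_proj N :: complex seq \<Rightarrow> complex seq) \<in> A_norm c0 c0 \<and>
      (\<forall>p. 1 \<le> p \<and> p \<le> \<infinity> \<longrightarrow> (seq_proj N :: complex seq \<Rightarrow> complex seq) \<in> A_norm (lp p) (lp p)) \<and>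
      (seq_proj N :: complex seq \<Rightarrow> complex seq) \<in> A_nu (c0 :: (complex, complex seq) normed_space) \<and>
      (\<forall>p. 1 \<le> p \<and> p < \<infinity> \<longrightarrow>
         (seq_proj N :: complex seq \<Rightarrow> complex seq) \<in> A_nu (lp p :: (complex, complex seq) normed_space)))"
  \<comment> \<open>Both scalar fields belong to the sort used above, so each generic result is
    instantiated twice.\<close>
  by (simp add: seq_proj_in_A_norm_lp[OF assms] seq_proj_in_A_nu_lp[OF assms]
      max_projection.P_in_A_norm_max[OF max_projection_c0[OF assms]]
      max_projection.P_in_A_nu_max[OF max_projection_c0[OF assms]])

end
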